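(* Let $k\ge1$, $n=3^k$, and $f=\mathrm{Maj}_3^{\circ k}\colon\mathbb F_2^n\to\{+1,-1\}$. Then for every $0\le d\le n$ and every linear subspace $A\le\mathbb F_2^n$ of dimension $d$, $$\sum_{S\in A}\hat f(S)^2\le\frac{4d}{n}.$$
   Context: Boolean values are written as $\pm1$ (bit $0\mapsto+1$, bit $1\mapsto-1$); $\mathrm{Maj}_3\colon\mathbb F_2^3\to\{+1,-1\}$ is the majority of three bits, with Fourier expansion $\mathrm{Maj}_3=\frac12(\chi_{\{1\}}+\chi_{\{2\}}+\chi_{\{3\}}-\chi_{\{1,2,3\}})$ where $\chi_S(x)=(-1)^{\sum_{i\in S}x_i}$. Composition: for $f\colon\mathbb F_2^a\to\{\pm1\}$ and $g\colon\mathbb F_2^m\to\{\pm1\}$, $(f\circ g)(x)=f(g(x_1,\dots,x_m),g(x_{m+1},\dots,x_{2m}),\dots,g(x_{m(a-1)+1},\dots,x_{ma}))$ (values of $g$ converted back to bits). $\mathrm{Maj}_3^{\circ1}=\mathrm{Maj}_3$ and $\mathrm{Maj}_3^{\circ k}=\mathrm{Maj}_3\circ\mathrm{Maj}_3^{\circ(k-1)}$. Fourier coefficients: $\hat f(S)=\mathbb E_{x\sim U(\mathbb F_2^n)}[f(x)(-1)^{S\cdot x}]$. *)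

theory Defs
  imports Complex_Main "HOL-Library.Z2" "HOL-Library.Function_Algebras"
begin

text \<open>
  Vectors over the two-element field are functions from \<^typ>\<open>nat\<close> to \<^typ>\<open>bit\<close>; the space of
  dimension \<open>n\<close> consists of those vanishing outside the coordinates \<open>0, ..., n - 1\<close>
  (coordinates are counted from 0).
\<close>

definition F2vec :: "nat \<Rightarrow> (nat \<Rightarrow> bit) set" where
  "F2vec n = {x. \<forall>i\<ge>n. x i = 0}"

definition F2scale :: "bit \<Rightarrow> (nat \<Rightarrow> bit) \<Rightarrow> (nat \<Rightarrow> bit)" where
  "F2scale c x = (\<lambda>i. c * x i)"

global_interpretation F2: vector_space F2scale
  by unfold_locales
    (simp_all only: F2scale_def fun_eq_iff plus_fun_apply distrib_left distrib_right mult.assoc mult_1_left simp_thms)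

definition bit_sign :: "bit \<Rightarrow> real" where
  "bit_sign b = (if b = 0 then 1 else - 1)"

definition sign_bit :: "real \<Rightarrow> bit" where
  "sign_bit r = (if r = 1 then 0 else 1)"

definition Maj3 :: "(nat \<Rightarrow> bit) \<Rightarrow> real" where
  "Maj3 x = bit_sign (if 2 \<le> card {i. i < 3 \<and> x i = 1} then 1 else 0)"

text \<open>
  \<open>bool_comp a m f g\<close> is the composition of \<open>f\<close> of arity \<open>a\<close> with \<open>g\<close> of arity \<open>m\<close>; the \<open>j\<close>-th
  block of the input, moved to the coordinates \<open>0, ..., m - 1\<close>, is \<open>block m j x\<close>.
\<close>

definition block :: "nat \<Rightarrow> nat \<Rightarrow> (nat \<Rightarrow> bit) \<Rightarrow> (nat \<Rightarrow> bit)" where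
  "block m j x = (\<lambda>i. if i < m then x (j * m + i) else 0)"

definition bool_comp ::
  "nat \<Rightarrow> nat \<Rightarrow> ((nat \<Rightarrow> bit) \<Rightarrow> real) \<Rightarrow> ((nat \<Rightarrow> bit) \<Rightarrow> real) \<Rightarrow> (nat \<Rightarrow> bit) \<Rightarrow> real" where
  "bool_comp a m f g x = f (\<lambda>j. if j < a then sign_bit (g (block m j x)) else 0)"

text \<open>The value at exponent 0 is a convention only: the iterate is meant for positive exponents.\<close>

fun Maj3_iter :: "nat \<Rightarrow> (nat \<Rightarrow> bit) \<Rightarrow> real" where
  "Maj3_iter 0 = (\<lambda>x. bit_sign (x 0))"
| "Maj3_iter (Suc 0) = Maj3"
| "Maj3_iter (Suc (Suc k)) = bool_comp 3 (3 ^ Suc k) Maj3 (Maj3_iter (Suc k))"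

definition fourier_coeff :: "nat \<Rightarrow> ((nat \<Rightarrow> bit) \<Rightarrow> real) \<Rightarrow> (nat \<Rightarrow> bit) \<Rightarrow> real" where
  "fourier_coeff n f S =
     (\<Sum>x\<in>F2vec n. f x * bit_sign (\<Sum>i<n. S i * x i)) / real (card (F2vec n))"

end

theory Submission
  imports Defs
begin

text \<open>
  Let \<open>\<mu>\<close> be the squared Fourier coefficients of an iterate of arity \<open>m\<close>. Since \<open>\<mu> 0 = 0\<close>, those of
  the next iterate at a triple of blocks \<open>(a, b, c)\<close> are \<open>\<mu> a / 4\<close> if only \<open>a\<close> is nonzero (likewise
  for \<open>b\<close> and \<open>c\<close>) and \<open>\<mu> a * \<mu> b * \<mu> c / 4\<close> otherwise. One shows \<open>\<mu>(A) \<le> 4 dim A / n\<close> by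
  induction. Let \<open>A\<^sub>1, A\<^sub>2, A\<^sub>3\<close> be the intersections of \<open>A\<close> with the three coordinate blocks, of
  dimensions \<open>d\<^sub>1, d\<^sub>2, d\<^sub>3\<close> with sum \<open>D\<close>. The points of \<open>A\<close> supported on one block have mass at most
  \<open>D / m\<close>. If \<open>A = A\<^sub>1 \<times> A\<^sub>2 \<times> A\<^sub>3\<close>, the rest has mass at most
  \<open>min d\<^sub>i / m \<le> D / (3 m)\<close>. Otherwise \<open>D \<le> dim A - 1\<close>; conditioned on two blocks, the third lies in
  a coset of \<open>A\<^sub>i\<close>, hence in a subspace of dimension at most \<open>d\<^sub>i + 1\<close>, and the rest has mass at most
  \<open>(D / 3 + 1) / m\<close>. Both cases add up to at most \<open>4 dim A / (3 m)\<close>.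
\<close>

section \<open>Linear algebra and counting over the two-element field\<close>

lemma bit_fun_add_self [simp]: "x + x = (0 :: nat \<Rightarrow> bit)"
  by (rule ext) (simp add: plus_fun_def zero_fun_def)

lemma bit_fun_add_cancel [simp]: "x + (x + y) = (y :: nat \<Rightarrow> bit)"
  by (simp add: add.assoc [symmetric])

text \<open>The only scalars are 0 and 1, so closure under scaling comes for free.\<close>

lemma F2_subspaceI:
  assumes "0 \<in> A" and "\<And>x y. x \<in> A \<Longrightarrow> y \<in> A \<Longrightarrow> x + y \<in> A"
  shows "F2.subspace A"
proof (rule F2.subspaceI)
  fix c x assume "x \<in> A"
  have "F2scale c x = (if c = 0 then 0 else x)"
    by (cases c) (auto simp: F2scale_def fun_eq_iff)
  then show "F2scale c x \<in> A" using assms(1) \<open>x \<in> A\<close> by simp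
qed (use assms in auto)

lemma F2_add_mem_iff:
  assumes "F2.subspace A" and "x \<in> A"
  shows "x + y \<in> A \<longleftrightarrow> y \<in> A"
  using F2.subspace_add [OF assms(1,2), of y] F2.subspace_add [OF assms(1,2), of "x + y"] by auto

lemma F2vec_0 [simp]: "0 \<in> F2vec n"
  by (simp add: F2vec_def)

lemma F2vec_add [simp]: "x \<in> F2vec n \<Longrightarrow> y \<in> F2vec n \<Longrightarrow> x + y \<in> F2vec n"
  by (simp add: F2vec_def)

lemma finite_F2vec [simp]: "finite (F2vec n)"
proof -
  have "F2vec n = {x. \<forall>i. (i \<in> {..<n} \<longrightarrow> x i \<in> UNIV) \<and> (i \<notin> {..<n} \<longrightarrow> x i = 0)}"
    by (auto simp: F2vec_def)
  moreover have "finite (UNIV :: bit set)"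
  proof -
    have "(UNIV :: bit set) \<subseteq> {0, 1}" using bit_not_zero_iff by blast
    then show ?thesis using finite_subset by blast
  qed
  ultimately show ?thesis
    using finite_set_of_finite_funs [of "{..<n}" "UNIV :: bit set" 0] by simp
qed

lemma card_translate_bit: "card ((+) v ` A) = card (A :: (nat \<Rightarrow> bit) set)"
  by (rule card_image) (metis bit_fun_add_cancel inj_onI)

text \<open>Adjoining a vector \<open>v\<close> enlarges a span at most by its translate by
  \<open>v\<close>, so each generator at most doubles the size.\<close>

lemma card_F2_span_le:
  assumes "finite B"
  shows "finite (F2.span B) \<and> card (F2.span B) \<le> 2 ^ card B"
  using assms
proof (induction B)
  case empty
  then show ?case by simp
next
  case (insert v B)
  have sub: "F2.span (insert v B) \<subseteq> F2.span B \<union> (+) v ` F2.span B"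
  proof
    fix x assume "x \<in> F2.span (insert v B)"
    then obtain c where c: "x - F2scale c v \<in> F2.span B"
      by (auto simp: F2.span_insert)
    show "x \<in> F2.span B \<union> (+) v ` F2.span B"
    proof (cases "c = 0")
      case True
      with c show ?thesis by simp
    next
      case False
      then have "F2scale c v = v" by (cases c) (auto simp: F2scale_def)
      with c have "x - v \<in> F2.span B" by simp
      moreover have "x = v + (x - v)" by simp
      ultimately show ?thesis by blast
    qed
  qed
  have "card (F2.span (insert v B)) \<le> card (F2.span B \<union> (+) v ` F2.span B)"
    using insert sub by (intro card_mono) auto
  also have "\<dots> \<le> 2 * card (F2.span B)"
    using card_Un_le [of "F2.span B" "(+) v ` F2.span B"] by (simp add: card_translate_bit)
  also have "\<dots> \<le> 2 ^ card (insert v B)" using insert by simp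
  finally show ?case using insert sub by (meson finite_UnI finite_imageI finite_subset)
qed

lemma card_le_F2_dim:
  assumes "finite A"
  shows "card A \<le> 2 ^ F2.dim A"
proof -
  obtain B where B: "B \<subseteq> A" "F2.independent B" "A \<subseteq> F2.span B" "card B = F2.dim A"
    using F2.basis_exists by blast
  have "finite B" using B(1) assms finite_subset by blast
  have "card A \<le> card (F2.span B)"
    using card_F2_span_le [OF \<open>finite B\<close>] B(3) by (intro card_mono) auto
  then show ?thesis using card_F2_span_le [OF \<open>finite B\<close>] B(4) by auto
qed

text \<open>For \<open>v\<close> in \<open>A\<close> but not in \<open>B\<close>, the translate of
  \<open>B\<close> by \<open>v\<close> is a second copy of \<open>B\<close> inside \<open>A\<close>,
  disjoint from \<open>B\<close>. In logarithms, a proper inclusion gains at least 1.\<close>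

lemma card_proper_F2_subspace:
  assumes "F2.subspace A" and "finite A" and "F2.subspace B" and "B \<subset> A"
  shows "2 * card B \<le> card A"
proof -
  obtain v where v: "v \<in> A" "v \<notin> B" using assms(4) by blast
  have fin: "finite B" using assms finite_subset by blast
  have disj: "B \<inter> (+) v ` B = {}"
    using v F2_add_mem_iff [OF assms(3)] by (auto simp: add.commute)
  have "2 * card B = card (B \<union> (+) v ` B)"
    using fin disj by (simp add: card_Un_disjoint card_translate_bit)
  also have "\<dots> \<le> card A"
    using assms v F2.subspace_add [OF assms(1)] by (intro card_mono) auto
  finally show ?thesis .
qed

section \<open>Mass bounds for subspaces, cosets and fibres\<close>

text \<open>For a subspace this is the dimension; the induction needs only its behaviour under products,
  cosets and proper inclusion, which is plain counting.\<close>

definition log_card :: "'a set \<Rightarrow> real" where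
  "log_card A = log 2 (card A)"

text \<open>The invariant of the induction, stated for arbitrary weights so that the combinatorial
  step can be separated from Fourier analysis. Nonnegativity and total mass 1 are what allow
  averaging over blocks.\<close>

definition spread_measure :: "nat \<Rightarrow> ((nat \<Rightarrow> bit) \<Rightarrow> real) \<Rightarrow> bool" where
  "spread_measure n \<mu> \<longleftrightarrow>
     (\<forall>S. 0 \<le> \<mu> S) \<and> (\<Sum>S\<in>F2vec n. \<mu> S) = 1 \<and>
     (\<forall>A. F2.subspace A \<longrightarrow> A \<subseteq> F2vec n \<longrightarrow> sum \<mu> A \<le> 4 * log_card A / n)"

text \<open>Since \<open>v + v = 0\<close>, the union of \<open>A\<close> and its translate is again
  a subspace, with at most twice as many elements; passing to it costs at most 1 in the
  logarithm.\<close>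

lemma spread_measure_sum_coset:
  assumes \<mu>: "spread_measure n \<mu>" and A: "F2.subspace A" "A \<subseteq> F2vec n" and v: "v \<in> F2vec n"
  shows "sum \<mu> ((+) v ` A) \<le> 4 * (log_card A + 1) / n"
proof -
  let ?C = "A \<union> (+) v ` A"
  have fin: "finite A" using A(2) by (rule finite_subset) simp
  have pos: "0 < card A" using fin F2.subspace_0 [OF A(1)] by (auto simp: card_gt_0_iff)
  have sub: "?C \<subseteq> F2vec n" using A(2) v by auto
  have "F2.subspace ?C"
  proof (rule F2_subspaceI)
    show "0 \<in> ?C" using F2.subspace_0 [OF A(1)] by simp
    have mem: "x \<in> ?C \<longleftrightarrow> x \<in> A \<or> v + x \<in> A" for x
      by (metis Un_iff bit_fun_add_cancel imageE imageI)
    fix x y assume "x \<in> ?C" "y \<in> ?C"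
    moreover have "v + (x + y) = (v + x) + y" by (simp only: add.assoc)
    moreover have "v + (x + y) = x + (v + y)" by (simp only: add.left_commute)
    moreover have "x + y = (v + x) + (v + y)"
      by (metis add.assoc add.left_commute bit_fun_add_cancel)
    ultimately show "x + y \<in> ?C"
      unfolding mem using F2.subspace_add [OF A(1)] by metis
  qed
  then have "sum \<mu> ?C \<le> 4 * log_card ?C / n"
    using \<mu> sub by (simp add: spread_measure_def)
  moreover have "sum \<mu> ((+) v ` A) \<le> sum \<mu> ?C"
    using \<mu> fin by (intro sum_mono2) (auto simp: spread_measure_def)
  moreover have "log_card ?C \<le> log_card A + 1"
  proof -
    have "card ?C \<le> 2 * card A"
      using card_Un_le [of A "(+) v ` A"] by (simp add: card_translate_bit)
    moreover have "0 < card ?C" using pos fin by (simp add: card_gt_0_iff)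
    ultimately have "log 2 (card ?C) \<le> log 2 (2 * real (card A))"
      by (subst log_le_cancel_iff) auto
    also have "\<dots> = log 2 (card A) + 1" using pos by (simp add: log_mult)
    finally show ?thesis by (simp add: log_card_def)
  qed
  ultimately show ?thesis
    by (smt (verit) divide_right_mono of_nat_0_le_iff)
qed

text \<open>\<open>J\<close> is an arbitrary additive map so that the same statement serves all
  three blocks: the block of interest is moved to the first argument by permuting the
  others.\<close>

lemma F2_subspace_slice:
  fixes J :: "(nat \<Rightarrow> bit) \<Rightarrow> (nat \<Rightarrow> bit) \<Rightarrow> (nat \<Rightarrow> bit) \<Rightarrow> nat \<Rightarrow> bit"
  assumes J: "\<And>a b c a' b' c'. J (a + a') (b + b') (c + c') = J a b c + J a' b' c'"
    and A: "F2.subspace A"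
  shows "F2.subspace {a \<in> F2vec m. J a 0 0 \<in> A}"
proof (rule F2_subspaceI)
  have "J 0 0 0 = 0" using J [of 0 0 0 0 0 0] by simp
  then show "0 \<in> {a \<in> F2vec m. J a 0 0 \<in> A}" using F2.subspace_0 [OF A] by simp
  fix x y assume "x \<in> {a \<in> F2vec m. J a 0 0 \<in> A}" "y \<in> {a \<in> F2vec m. J a 0 0 \<in> A}"
  then show "x + y \<in> {a \<in> F2vec m. J a 0 0 \<in> A}"
    using J [of x y 0 0 0 0] F2.subspace_add [OF A] by simp
qed

lemma sum3_mult:
  fixes u v w :: "'a \<Rightarrow> real"
  shows "(\<Sum>x\<in>V. \<Sum>y\<in>V. \<Sum>z\<in>V. u x * v y * w z) = sum u V * sum v V * sum w V"
  by (simp add: sum_distrib_left [symmetric] sum_distrib_right [symmetric])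

text \<open>Conditioned on \<open>b\<close> and \<open>c\<close>, the admissible \<open>a\<close> form a coset of the slice of \<open>A\<close>.\<close>

lemma spread_measure_triple:
  fixes J :: "(nat \<Rightarrow> bit) \<Rightarrow> (nat \<Rightarrow> bit) \<Rightarrow> (nat \<Rightarrow> bit) \<Rightarrow> nat \<Rightarrow> bit"
  assumes J: "\<And>a b c a' b' c'. J (a + a') (b + b') (c + c') = J a b c + J a' b' c'"
    and \<mu>: "spread_measure m \<mu>" and A: "F2.subspace A"
    and \<epsilon>: "\<epsilon> = 1 \<or> \<epsilon> = 0 \<and> (\<forall>a\<in>F2vec m. \<forall>b\<in>F2vec m. \<forall>c\<in>F2vec m. J a b c \<in> A \<longrightarrow> J a 0 0 \<in> A)"
  defines "A\<^sub>1 \<equiv> {a \<in> F2vec m. J a 0 0 \<in> A}"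
  shows "(\<Sum>b\<in>F2vec m. \<Sum>c\<in>F2vec m. \<Sum>a\<in>F2vec m. of_bool (J a b c \<in> A) * (\<mu> a * \<mu> b * \<mu> c))
           \<le> 4 * (log_card A\<^sub>1 + \<epsilon>) / m"
    (is "?lhs \<le> ?r")
proof -
  have A1: "F2.subspace A\<^sub>1" "A\<^sub>1 \<subseteq> F2vec m"
    using F2_subspace_slice [where J = J, OF J A] by (auto simp: A\<^sub>1_def)
  have pos: "0 \<le> \<mu> S" for S using \<mu> by (simp add: spread_measure_def)
  have tot: "(\<Sum>S\<in>F2vec m. \<mu> S) = 1" using \<mu> by (simp add: spread_measure_def)
  have "0 < card A\<^sub>1"
    using A1 F2.subspace_0 [OF A1(1)] finite_subset [OF A1(2)] by (auto simp: card_gt_0_iff)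
  then have L: "0 \<le> log_card A\<^sub>1" by (simp add: log_card_def)
  \<comment> \<open>\<open>\<epsilon>\<close> is the price of a shift. With
    \<open>\<epsilon> = 1\<close> the fibre is empty or lies in a coset of the slice, represented by
    any of its points \<open>v\<close>; with \<open>\<epsilon> = 0\<close> it lies in the slice
    itself.\<close>
  have fibre: "(\<Sum>a\<in>F2vec m. of_bool (J a b c \<in> A) * \<mu> a) \<le> ?r"
    if bc: "b \<in> F2vec m" "c \<in> F2vec m" for b c
  proof -
    let ?F = "{a \<in> F2vec m. J a b c \<in> A}"
    have eq: "(\<Sum>a\<in>F2vec m. of_bool (J a b c \<in> A) * \<mu> a) = sum \<mu> ?F"
      by (rule sum.mono_neutral_cong_right) auto
    show ?thesis
    proof (cases "\<epsilon> = 1")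
      case True
      show ?thesis
      proof (cases "?F = {}")
        case True
        have "sum \<mu> ?F = 0" by (subst True) simp
        then show ?thesis unfolding eq using L \<open>\<epsilon> = 1\<close> by simp
      next
        case False
        then obtain v where v: "v \<in> F2vec m" "J v b c \<in> A" by blast
        have "?F \<subseteq> (+) v ` A\<^sub>1"
        proof
          fix a assume a: "a \<in> ?F"
          then have "J (v + a) 0 0 \<in> A"
            using J [of v a b b c c] F2.subspace_add [OF A v(2), of "J a b c"] by simp
          then have "v + a \<in> A\<^sub>1" using a v by (simp add: A\<^sub>1_def)
          then show "a \<in> (+) v ` A\<^sub>1" by (metis bit_fun_add_cancel imageI)
        qed
        then have "sum \<mu> ?F \<le> sum \<mu> ((+) v ` A\<^sub>1)"
          using pos finite_subset [OF A1(2)] by (intro sum_mono2) auto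
        then show ?thesis
          using spread_measure_sum_coset [OF \<mu> A1 v(1)] \<open>\<epsilon> = 1\<close> eq by simp
      qed
    next
      case False
      with \<epsilon> have "\<epsilon> = 0" "?F \<subseteq> A\<^sub>1" using bc by (auto simp: A\<^sub>1_def)
      have "sum \<mu> ?F \<le> sum \<mu> A\<^sub>1"
        using pos A1(2) \<open>?F \<subseteq> A\<^sub>1\<close> by (intro sum_mono2) (auto intro: finite_subset)
      also have "\<dots> \<le> ?r" using \<mu> A1 \<open>\<epsilon> = 0\<close> by (simp add: spread_measure_def)
      finally show ?thesis using eq by simp
    qed
  qed
  \<comment> \<open>The fibre bound is uniform in \<open>b\<close> and \<open>c\<close>, so
    averaging it with weights \<open>\<mu> b * \<mu> c\<close> of total mass 1 preserves it.\<close>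
  have "?lhs = (\<Sum>b\<in>F2vec m. \<Sum>c\<in>F2vec m.
                  \<mu> b * \<mu> c * (\<Sum>a\<in>F2vec m. of_bool (J a b c \<in> A) * \<mu> a))"
    by (simp only: sum_distrib_left mult_ac)
  also have "\<dots> \<le> (\<Sum>b\<in>F2vec m. \<Sum>c\<in>F2vec m. \<mu> b * \<mu> c * ?r)"
    using fibre pos by (intro sum_mono mult_left_mono) auto
  also have "\<dots> = (\<Sum>b\<in>F2vec m. \<mu> b) * (\<Sum>c\<in>F2vec m. \<mu> c) * ?r"
    by (simp only: sum_distrib_right [symmetric] sum_product [symmetric])
  finally show ?thesis using tot by simp
qed

section \<open>Triples of blocks and the induction step for subspace masses\<close>

definition join3 :: "nat \<Rightarrow> (nat \<Rightarrow> bit) \<Rightarrow> (nat \<Rightarrow> bit) \<Rightarrow> (nat \<Rightarrow> bit) \<Rightarrow> nat \<Rightarrow> bit" where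
  "join3 m a b c = (\<lambda>i. if i < m then a i else if i < 2 * m then b (i - m)
                        else if i < 3 * m then c (i - 2 * m) else 0)"

lemma join3_add: "join3 m (a + a') (b + b') (c + c') = join3 m a b c + join3 m a' b' c'"
  by (rule ext) (simp add: join3_def)

lemma block_join3:
  assumes "a \<in> F2vec m" "b \<in> F2vec m" "c \<in> F2vec m"
  shows "block m 0 (join3 m a b c) = a" "block m (Suc 0) (join3 m a b c) = b"
    "block m 2 (join3 m a b c) = c"
  using assms by (auto simp: block_def join3_def F2vec_def fun_eq_iff)

lemma bij_betw_join3:
  "bij_betw (\<lambda>(a, b, c). join3 m a b c) (F2vec m \<times> F2vec m \<times> F2vec m) (F2vec (3 * m))"
proof (rule bij_betw_byWitness [where f' = "\<lambda>x. (block m 0 x, block m (Suc 0) x, block m 2 x)"])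
  show "\<forall>x\<in>F2vec (3 * m). (case (block m 0 x, block m (Suc 0) x, block m 2 x) of
          (a, b, c) \<Rightarrow> join3 m a b c) = x"
    by (auto simp: join3_def block_def F2vec_def fun_eq_iff)
  show "(\<lambda>(a, b, c). join3 m a b c) ` (F2vec m \<times> F2vec m \<times> F2vec m) \<subseteq> F2vec (3 * m)"
    by (auto simp: join3_def F2vec_def)
qed (auto simp: block_join3, auto simp: block_def F2vec_def)

lemma sum_F2vec_join3:
  "(\<Sum>x\<in>F2vec (3 * m). h x) = (\<Sum>a\<in>F2vec m. \<Sum>b\<in>F2vec m. \<Sum>c\<in>F2vec m. h (join3 m a b c))"
  by (subst sum.reindex_bij_betw [OF bij_betw_join3, symmetric])
     (simp add: sum.cartesian_product case_prod_beta)

lemma card_F2vec_join3: "card (F2vec (3 * m)) = card (F2vec m) ^ 3"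
  using bij_betw_same_card [OF bij_betw_join3, of m]
  by (simp add: card_cartesian_product power3_eq_cube)

text \<open>The induction step without Fourier analysis. The hypothesis on \<open>\<nu>\<close> is
  the squared recursion for the coefficients of a composition with \<open>Maj3\<close>; each of its
  four terms has total mass 1.\<close>

lemma spread_measure_join3:
  assumes \<mu>: "spread_measure m \<mu>" and \<nu>_nonneg: "\<And>S. 0 \<le> \<nu> S"
    and \<nu>: "\<And>a b c. a \<in> F2vec m \<Longrightarrow> b \<in> F2vec m \<Longrightarrow> c \<in> F2vec m \<Longrightarrow>
      4 * \<nu> (join3 m a b c) = \<mu> a * of_bool (b = 0) * of_bool (c = 0)
        + of_bool (a = 0) * \<mu> b * of_bool (c = 0) + of_bool (a = 0) * of_bool (b = 0) * \<mu> c
        + \<mu> a * \<mu> b * \<mu> c"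
  shows "spread_measure (3 * m) \<nu>"
proof -
  let ?V = "F2vec m"
  have tot: "(\<Sum>S\<in>?V. \<mu> S) = 1" using \<mu> by (simp add: spread_measure_def)
  have pick: "(\<Sum>S\<in>?V. of_bool (S = 0) * h S) = h 0" for h :: "(nat \<Rightarrow> bit) \<Rightarrow> real"
    by (subst sum.mono_neutral_cong_right [of ?V "{0}" _ h]) auto
  \<comment> \<open>A general weight \<open>\<phi>\<close> covers both uses: the constant 1 gives
    the total mass, the indicator of \<open>A\<close> the mass of a subspace.\<close>
  have expand: "4 * (\<Sum>x\<in>F2vec (3 * m). \<phi> x * \<nu> x) =
      (\<Sum>a\<in>?V. \<phi> (join3 m a 0 0) * \<mu> a) + (\<Sum>b\<in>?V. \<phi> (join3 m 0 b 0) * \<mu> b)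
      + (\<Sum>c\<in>?V. \<phi> (join3 m 0 0 c) * \<mu> c)
      + (\<Sum>a\<in>?V. \<Sum>b\<in>?V. \<Sum>c\<in>?V. \<phi> (join3 m a b c) * (\<mu> a * \<mu> b * \<mu> c))" for \<phi> :: "_ \<Rightarrow> real"
  proof -
    have "4 * (\<Sum>x\<in>F2vec (3 * m). \<phi> x * \<nu> x) =
      (\<Sum>a\<in>?V. \<Sum>b\<in>?V. \<Sum>c\<in>?V. \<phi> (join3 m a b c) * (4 * \<nu> (join3 m a b c)))"
      by (simp add: sum_F2vec_join3 sum_distrib_left mult.left_commute)
    also have "\<dots> = (\<Sum>a\<in>?V. \<Sum>b\<in>?V. \<Sum>c\<in>?V.
        of_bool (c = 0) * (of_bool (b = 0) * (\<phi> (join3 m a b c) * \<mu> a))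
        + of_bool (c = 0) * (of_bool (a = 0) * (\<phi> (join3 m a b c) * \<mu> b))
        + of_bool (b = 0) * (of_bool (a = 0) * (\<phi> (join3 m a b c) * \<mu> c))
        + \<phi> (join3 m a b c) * (\<mu> a * \<mu> b * \<mu> c))"
      by (intro sum.cong refl) (simp only: \<nu>, simp add: algebra_simps)
    also have "\<dots> = (\<Sum>a\<in>?V. \<phi> (join3 m a 0 0) * \<mu> a) + (\<Sum>b\<in>?V. \<phi> (join3 m 0 b 0) * \<mu> b)
      + (\<Sum>c\<in>?V. \<phi> (join3 m 0 0 c) * \<mu> c)
      + (\<Sum>a\<in>?V. \<Sum>b\<in>?V. \<Sum>c\<in>?V. \<phi> (join3 m a b c) * (\<mu> a * \<mu> b * \<mu> c))"
      by (simp only: sum.distrib sum_distrib_left [symmetric] pick)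
    finally show ?thesis .
  qed
  have "4 * (\<Sum>x\<in>F2vec (3 * m). \<nu> x) = 4"
    using expand [of "\<lambda>_. 1"] tot sum3_mult [of \<mu> \<mu> \<mu> ?V] by simp
  moreover have "sum \<nu> A \<le> 4 * log_card A / (3 * m)"
    if A: "F2.subspace A" "A \<subseteq> F2vec (3 * m)" for A
  proof -
    define A1 where "A1 = {a \<in> ?V. join3 m a 0 0 \<in> A}"
    define A2 where "A2 = {b \<in> ?V. join3 m 0 b 0 \<in> A}"
    define A3 where "A3 = {c \<in> ?V. join3 m 0 0 c \<in> A}"
    note sub1 = F2_subspace_slice [where J = "join3 m", OF join3_add A(1), of m, folded A1_def]
    note sub2 = F2_subspace_slice [where J = "\<lambda>b a c. join3 m a b c", OF join3_add A(1), of m, folded A2_def]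
    note sub3 = F2_subspace_slice [where J = "\<lambda>c a b. join3 m a b c", OF join3_add A(1), of m, folded A3_def]
    have finA: "finite A" using A(2) by (rule finite_subset) simp
    have fins: "finite A1" "finite A2" "finite A3" by (auto simp: A1_def A2_def A3_def)
    have card_pos: "0 < card A" "0 < card A1" "0 < card A2" "0 < card A3"
      using F2.subspace_0 [OF A(1)] F2.subspace_0 [OF sub1] F2.subspace_0 [OF sub2]
        F2.subspace_0 [OF sub3] finA fins by (auto simp: card_gt_0_iff)
    let ?P = "\<Sum>a\<in>?V. \<Sum>b\<in>?V. \<Sum>c\<in>?V. of_bool (join3 m a b c \<in> A) * (\<mu> a * \<mu> b * \<mu> c)"
    have slice: "(\<Sum>a\<in>?V. of_bool (j a \<in> A) * \<mu> a) = sum \<mu> {a \<in> ?V. j a \<in> A}" for j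
      by (rule sum.mono_neutral_cong_right) auto
    have "sum \<nu> A = (\<Sum>x\<in>F2vec (3 * m). of_bool (x \<in> A) * \<nu> x)"
      using A(2) by (intro sum.mono_neutral_cong_left) auto
    then have main: "4 * sum \<nu> A = sum \<mu> A1 + sum \<mu> A2 + sum \<mu> A3 + ?P"
      using expand [of "\<lambda>x. of_bool (x \<in> A)"] by (simp only: slice A1_def A2_def A3_def)
    have s: "sum \<mu> A1 \<le> 4 * log_card A1 / m" "sum \<mu> A2 \<le> 4 * log_card A2 / m"
      "sum \<mu> A3 \<le> 4 * log_card A3 / m"
      using \<mu> sub1 sub2 sub3 by (auto simp: spread_measure_def A1_def A2_def A3_def)
    \<comment> \<open>The product term is written with each block in turn summed innermost, ready
      for conditioning on the other two.\<close>
    have P2: "?P = (\<Sum>a\<in>?V. \<Sum>c\<in>?V. \<Sum>b\<in>?V. of_bool (join3 m a b c \<in> A) * (\<mu> b * \<mu> a * \<mu> c))"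
      by (subst sum.swap) (simp add: mult_ac)
    have P3: "?P = (\<Sum>a\<in>?V. \<Sum>b\<in>?V. \<Sum>c\<in>?V. of_bool (join3 m a b c \<in> A) * (\<mu> c * \<mu> a * \<mu> b))"
      by (simp add: mult_ac)
    have P1: "?P = (\<Sum>b\<in>?V. \<Sum>c\<in>?V. \<Sum>a\<in>?V. of_bool (join3 m a b c \<in> A) * (\<mu> a * \<mu> b * \<mu> c))"
    proof -
      have "?P = (\<Sum>b\<in>?V. \<Sum>a\<in>?V. \<Sum>c\<in>?V. of_bool (join3 m a b c \<in> A) * (\<mu> a * \<mu> b * \<mu> c))"
        by (rule sum.swap)
      also have "\<dots> = (\<Sum>b\<in>?V. \<Sum>c\<in>?V. \<Sum>a\<in>?V. of_bool (join3 m a b c \<in> A) * (\<mu> a * \<mu> b * \<mu> c))"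
        by (intro sum.cong refl sum.swap)
      finally show ?thesis .
    qed
    \<comment> \<open>\<open>B\<close> is the largest product of three block subspaces inside
      \<open>A\<close>; its logarithmic size is the sum of those of the slices.\<close>
    define B where "B = (\<lambda>(a, b, c). join3 m a b c) ` (A1 \<times> A2 \<times> A3)"
    have split: "join3 m a b c = join3 m a 0 0 + (join3 m 0 b 0 + join3 m 0 0 c)" for a b c
      by (simp add: join3_add [symmetric])
    have "B \<subseteq> A"
    proof
      fix x assume "x \<in> B"
      then obtain a b c where x: "x = join3 m a b c" and "a \<in> A1" "b \<in> A2" "c \<in> A3"
        by (auto simp: B_def)
      then have "join3 m a 0 0 + (join3 m 0 b 0 + join3 m 0 0 c) \<in> A"
        by (intro F2.subspace_add [OF A(1)]) (auto simp: A1_def A2_def A3_def)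
      then show "x \<in> A" by (simp only: x split [of a b c])
    qed
    have inj: "inj_on (\<lambda>(a, b, c). join3 m a b c) (?V \<times> ?V \<times> ?V)"
      using bij_betw_join3 by (rule bij_betw_imp_inj_on)
    have "A1 \<times> A2 \<times> A3 \<subseteq> ?V \<times> ?V \<times> ?V" by (auto simp: A1_def A2_def A3_def)
    then have cardB: "card B = card A1 * (card A2 * card A3)"
      unfolding B_def by (subst card_image [OF inj_on_subset [OF inj]]) (auto simp: card_cartesian_product)
    then have logB: "log_card B = log_card A1 + log_card A2 + log_card A3"
      using card_pos by (simp add: log_card_def log_mult)
    have "F2.subspace B"
    proof (rule F2_subspaceI)
      have "join3 m 0 0 0 = 0" by (simp add: join3_def fun_eq_iff)
      then show "0 \<in> B"
        using F2.subspace_0 [OF sub1] F2.subspace_0 [OF sub2] F2.subspace_0 [OF sub3]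
        unfolding B_def by force
      fix x y assume "x \<in> B" "y \<in> B"
      then obtain a b c a' b' c' where
        "x = join3 m a b c" "a \<in> A1" "b \<in> A2" "c \<in> A3"
        "y = join3 m a' b' c'" "a' \<in> A1" "b' \<in> A2" "c' \<in> A3"
        by (auto simp: B_def)
      then have "x + y = join3 m (a + a') (b + b') (c + c')"
        "a + a' \<in> A1" "b + b' \<in> A2" "c + c' \<in> A3"
        using F2.subspace_add [OF sub1] F2.subspace_add [OF sub2] F2.subspace_add [OF sub3]
        by (auto simp: join3_add)
      then show "x + y \<in> B" unfolding B_def by force
    qed
    \<comment> \<open>If \<open>B\<close> is proper, the doubling of cardinality gains the unit that
      pays for the coset shift; if \<open>B = A\<close>, no shift occurs.\<close>
    obtain \<epsilon> :: real where \<epsilon>: "0 \<le> \<epsilon>" "log_card A \<ge> log_card B + \<epsilon>"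
      and dich: "\<epsilon> = 1 \<or> \<epsilon> = 0 \<and> B = A"
    proof (cases "B = A")
      case True
      then show ?thesis using that [of 0] by simp
    next
      case False
      then have "2 * card B \<le> card A"
        using card_proper_F2_subspace A(1) finA \<open>F2.subspace B\<close> \<open>B \<subseteq> A\<close> by blast
      moreover have "0 < card B" using card_pos cardB by simp
      ultimately have "log 2 (2 * real (card B)) \<le> log 2 (card A)"
        by (subst log_le_cancel_iff) auto
      then have "log_card A \<ge> log_card B + 1"
        using card_pos cardB by (simp add: log_card_def log_mult)
      then show ?thesis using that [of 1] by simp
    qed
    \<comment> \<open>When \<open>A\<close> is a product, injectivity of \<open>join3\<close> forces
      each block of a point of \<open>A\<close> into its slice. This is the condition for using
      \<open>\<epsilon> = 0\<close> in the fibre bound.\<close>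
    have mem: "a \<in> A1 \<and> b \<in> A2 \<and> c \<in> A3"
      if "B = A" "a \<in> ?V" "b \<in> ?V" "c \<in> ?V" "join3 m a b c \<in> A" for a b c
    proof -
      have "join3 m a b c \<in> B" using that by simp
      then obtain a' b' c' where
        *: "join3 m a b c = join3 m a' b' c'" "a' \<in> A1" "b' \<in> A2" "c' \<in> A3"
        by (auto simp: B_def)
      then have "(a, b, c) = (a', b', c')"
        using that by (intro inj_onD [OF inj]) (auto simp: A1_def A2_def A3_def)
      with * show ?thesis by simp
    qed
    have "?P \<le> 4 * (log_card A1 + \<epsilon>) / m"
      unfolding P1 A1_def
      by (rule spread_measure_triple [where J = "join3 m", OF join3_add \<mu> A(1)])
        (use dich mem in \<open>auto simp: A1_def\<close>)
    moreover have "?P \<le> 4 * (log_card A2 + \<epsilon>) / m"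
      unfolding P2 A2_def
      by (rule spread_measure_triple [where J = "\<lambda>b a c. join3 m a b c", OF join3_add \<mu> A(1)])
        (use dich mem in \<open>auto simp: A2_def\<close>)
    moreover have "?P \<le> 4 * (log_card A3 + \<epsilon>) / m"
      unfolding P3 A3_def
      by (rule spread_measure_triple [where J = "\<lambda>c a b. join3 m a b c", OF join3_add \<mu> A(1)])
        (use dich mem in \<open>auto simp: A3_def\<close>)
    \<comment> \<open>Three times \<open>main\<close>, with each copy of \<open>?P\<close> bounded
      through a different block. If \<open>D\<close> is the sum of the slice logarithms, this gives
      \<open>12 * D + 4 * (D + 3 * \<epsilon>)\<close> over \<open>m\<close>.\<close>
    ultimately have "12 * sum \<nu> A \<le>
        4 * (4 * (log_card A1 + log_card A2 + log_card A3) + 3 * \<epsilon>) / m"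
      using main s by (simp add: add_divide_distrib distrib_left)
    \<comment> \<open>Here \<open>4 * D + 3 * \<epsilon> \<le> 4 * (D + \<epsilon>)\<close>, and
      \<open>D + \<epsilon>\<close> is at most \<open>log_card A\<close>.\<close>
    also have "\<dots> \<le> 4 * (4 * log_card A) / m"
      using \<epsilon> logB by (intro divide_right_mono) auto
    finally show ?thesis by simp
  qed
  ultimately show ?thesis using \<nu>_nonneg by (simp add: spread_measure_def)
qed

section \<open>Fourier coefficients of a composition with the majority of three\<close>

lemma bit_sign_add: "bit_sign (a + b) = bit_sign a * bit_sign b"
  by (cases a; cases b) (auto simp: bit_sign_def)

text \<open>If \<open>S j\<close> is nonzero, translation by the unit vector at \<open>j\<close>
  permutes the space and negates the character, so the sum equals its own negative.\<close>

lemma fourier_coeff_one: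
  assumes "S \<in> F2vec n"
  shows "fourier_coeff n (\<lambda>_. 1) S = of_bool (S = 0)"
proof (cases "S = 0")
  case True
  have "card (F2vec n) \<noteq> 0" using F2vec_0 finite_F2vec by (metis card_0_eq empty_iff)
  then show ?thesis using True by (simp add: fourier_coeff_def bit_sign_def)
next
  case False
  then obtain j where j: "S j \<noteq> 0" by (auto simp: fun_eq_iff)
  with assms have "j < n" by (auto simp: F2vec_def not_le [symmetric])
  define e where "e = (\<lambda>i. if i = j then 1 else 0 :: bit)"
  have e: "e \<in> F2vec n" using \<open>j < n\<close> by (simp add: e_def F2vec_def)
  have "(\<Sum>i<n. S i * e i) = S j"
  proof -
    have "S i * e i = (if i = j then S j else 0)" for i by (simp add: e_def)
    then show ?thesis using \<open>j < n\<close> by (simp only: sum.delta finite_lessThan lessThan_iff if_True)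
  qed
  then have *: "bit_sign (\<Sum>i<n. S i * (e + x) i) = - bit_sign (\<Sum>i<n. S i * x i)" for x
    using j by (simp only: plus_fun_apply distrib_left sum.distrib bit_sign_add) (simp add: bit_sign_def)
  have "bij_betw ((+) e) (F2vec n) (F2vec n)"
    by (rule bij_betw_byWitness [where f' = "(+) e"]) (use e in auto)
  then have "(\<Sum>x\<in>F2vec n. bit_sign (\<Sum>i<n. S i * x i))
      = (\<Sum>x\<in>F2vec n. bit_sign (\<Sum>i<n. S i * (e + x) i))"
    by (rule sum.reindex_bij_betw [symmetric])
  then have "(\<Sum>x\<in>F2vec n. bit_sign (\<Sum>i<n. S i * x i)) = 0"
    unfolding * by (simp add: sum_negf)
  then show ?thesis using False by (simp add: fourier_coeff_def)
qed

lemma sum_lessThan_add: "(\<Sum>i<m + n. h i) = (\<Sum>i<m. h i) + (\<Sum>i<n. h (m + i :: nat))"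
  for h :: "nat \<Rightarrow> 'a :: comm_monoid_add"
  by (induction n) (simp_all add: add.assoc)

lemma sum_mult_join3:
  "(\<Sum>i<3 * m. join3 m a b c i * join3 m x y z i)
     = (\<Sum>i<m. a i * x i) + (\<Sum>i<m. b i * y i) + (\<Sum>i<m. c i * z i)"
proof -
  have "3 * m = m + m + m" by simp
  then show ?thesis
    by (simp only: sum_lessThan_add) (intro arg_cong2 [where f = "(+)"] sum.cong refl; simp add: join3_def)
qed

text \<open>The Fourier expansion of majority read as a polynomial in the signs, doubled to clear
  the fraction.\<close>

lemma Maj3_sign_bit:
  assumes "\<And>j. j < 3 \<Longrightarrow> r j = 1 \<or> r j = - 1"
  shows "2 * Maj3 (\<lambda>j. if j < 3 then sign_bit (r j) else 0)
    = r 0 + r (Suc 0) + r 2 - r 0 * r (Suc 0) * r 2"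
proof -
  have set: "{i. i < 3 \<and> (if i < 3 then sign_bit (r i) else 0) = 1}
      = (if r 0 = - 1 then {0} else {}) \<union> (if r (Suc 0) = - 1 then {Suc 0} else {})
        \<union> (if r 2 = - 1 then {2} else {})"
    using assms [of 0] assms [of "Suc 0"] assms [of 2]
    by (auto simp: sign_bit_def less_Suc_eq numeral_3_eq_3 numeral_2_eq_2 split: if_splits)
  have "r 0 = 1 \<or> r 0 = - 1" "r (Suc 0) = 1 \<or> r (Suc 0) = - 1" "r 2 = 1 \<or> r 2 = - 1"
    using assms by simp_all
  then show ?thesis
    unfolding Maj3_def set by (elim disjE) (simp_all add: bit_sign_def)
qed

text \<open>After expanding majority, every monomial is a product over independent blocks, so its
  coefficient factorises. A block absent from the monomial contributes a coefficient of the constant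
  1, hence the indicators.\<close>

lemma fourier_coeff_Maj3_comp:
  assumes g: "\<And>x. g x = 1 \<or> g x = - 1"
    and abc: "a \<in> F2vec m" "b \<in> F2vec m" "c \<in> F2vec m"
  defines "G \<equiv> fourier_coeff m g"
  shows "2 * fourier_coeff (3 * m) (bool_comp 3 m Maj3 g) (join3 m a b c)
    = G a * of_bool (b = 0) * of_bool (c = 0) + of_bool (a = 0) * G b * of_bool (c = 0)
      + of_bool (a = 0) * of_bool (b = 0) * G c - G a * G b * G c"
proof -
  let ?V = "F2vec m"
  define N where "N = real (card ?V)"
  define \<chi> where "\<chi> s x = bit_sign (\<Sum>i<m. s i * x i)" for s x :: "nat \<Rightarrow> bit"
  define U where "U s = (\<Sum>x\<in>?V. g x * \<chi> s x)" for s
  define E where "E s = (\<Sum>x\<in>?V. \<chi> s x)" for s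
  have G: "G s = U s / N" for s by (simp add: G_def fourier_coeff_def U_def \<chi>_def N_def)
  have D: "of_bool (s = 0) = E s / N" if "s \<in> ?V" for s
    using fourier_coeff_one [OF that] by (simp add: fourier_coeff_def E_def \<chi>_def N_def)
  have "2 * (\<Sum>x\<in>F2vec (3 * m). bool_comp 3 m Maj3 g x * bit_sign (\<Sum>i<3 * m. join3 m a b c i * x i))
    = (\<Sum>x\<in>?V. \<Sum>y\<in>?V. \<Sum>z\<in>?V. 2 * bool_comp 3 m Maj3 g (join3 m x y z) * (\<chi> a x * \<chi> b y * \<chi> c z))"
    unfolding sum_F2vec_join3 sum_mult_join3 bit_sign_add \<chi>_def
    by (simp add: sum_distrib_left mult.assoc)
  also have "\<dots> = (\<Sum>x\<in>?V. \<Sum>y\<in>?V. \<Sum>z\<in>?V.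
      (g x * \<chi> a x) * \<chi> b y * \<chi> c z + \<chi> a x * (g y * \<chi> b y) * \<chi> c z
      + \<chi> a x * \<chi> b y * (g z * \<chi> c z) - (g x * \<chi> a x) * (g y * \<chi> b y) * (g z * \<chi> c z))"
  proof (intro sum.cong refl)
    fix x y z assume "x \<in> ?V" "y \<in> ?V" "z \<in> ?V"
    then have "2 * bool_comp 3 m Maj3 g (join3 m x y z) = g x + g y + g z - g x * g y * g z"
      unfolding bool_comp_def using g by (subst Maj3_sign_bit) (auto simp: block_join3)
    then show "2 * bool_comp 3 m Maj3 g (join3 m x y z) * (\<chi> a x * \<chi> b y * \<chi> c z)
      = (g x * \<chi> a x) * \<chi> b y * \<chi> c z + \<chi> a x * (g y * \<chi> b y) * \<chi> c z
      + \<chi> a x * \<chi> b y * (g z * \<chi> c z) - (g x * \<chi> a x) * (g y * \<chi> b y) * (g z * \<chi> c z)"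
      by (simp only:) (simp add: algebra_simps)
  qed
  also have "\<dots> = U a * E b * E c + E a * U b * E c + E a * E b * U c - U a * U b * U c"
    by (simp only: sum.distrib sum_subtractf sum3_mult U_def E_def)
  finally show ?thesis
    unfolding fourier_coeff_def [of "3 * m"] card_F2vec_join3 G D [OF abc(1)] D [OF abc(2)] D [OF abc(3)]
    by (simp add: N_def [symmetric] power3_eq_cube add_divide_distrib diff_divide_distrib)
qed

section \<open>The iterates of majority and the final bound\<close>

lemma Maj3_iter_Suc: "Maj3_iter (Suc k) = bool_comp 3 (3 ^ k) Maj3 (Maj3_iter k)"
proof (cases k)
  \<comment> \<open>The convention at exponent 0 makes the iterate a single input bit, so the
    recursion also holds there and the induction can start from a dictator.\<close>
  case 0
  have "sign_bit (bit_sign b) = b" for b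
    by (cases b) (auto simp: sign_bit_def bit_sign_def)
  moreover have "{i. i < (3::nat) \<and> (if i < 3 then x i else 0) = 1} = {i. i < 3 \<and> x i = 1}"
    for x :: "nat \<Rightarrow> bit" by auto
  ultimately show ?thesis
    using 0 by (simp add: fun_eq_iff bool_comp_def block_def Maj3_def)
qed simp

lemma Maj3_iter_sign: "Maj3_iter k x = 1 \<or> Maj3_iter k x = - 1"
proof (cases k)
  case 0
  then show ?thesis by (simp add: bit_sign_def)
next
  case (Suc j)
  then show ?thesis by (simp only: Maj3_iter_Suc bool_comp_def Maj3_def bit_sign_def) simp
qed

lemma F2vec_1: "F2vec 1 = {0, \<lambda>i. if i = 0 then 1 else 0}"
proof
  show "F2vec 1 \<subseteq> {0, \<lambda>i. if i = 0 then 1 else 0}"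
  proof
    fix x assume "x \<in> F2vec 1"
    then have z: "x i = 0" if "0 < i" for i using that by (simp add: F2vec_def)
    show "x \<in> {0, \<lambda>i. if i = 0 then 1 else 0}"
      by (cases "x 0") (auto simp: fun_eq_iff z, metis z neq0_conv)
  qed
qed (auto simp: F2vec_def)

lemma fourier_coeff_dictator:
  assumes "S \<in> F2vec 1"
  shows "fourier_coeff 1 (\<lambda>x. bit_sign (x 0)) S = of_bool (S \<noteq> 0)"
proof -
  define e :: "nat \<Rightarrow> bit" where "e = (\<lambda>i. if i = 0 then 1 else 0)"
  have ne: "e \<noteq> 0" "e 0 = 1" by (auto simp: e_def fun_eq_iff)
  with assms show ?thesis
    unfolding fourier_coeff_def F2vec_1 e_def [symmetric] by (auto simp: bit_sign_def)
qed

text \<open>The vanishing coefficient at 0 is carried along because it removes the cross terms when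
  the recursion is squared.\<close>

lemma spread_measure_Maj3_iter:
  "fourier_coeff (3 ^ k) (Maj3_iter k) (0 :: nat \<Rightarrow> bit) = 0 \<and>
   spread_measure (3 ^ k) (\<lambda>S. (fourier_coeff (3 ^ k) (Maj3_iter k) S)\<^sup>2)"
proof (induction k)
  case 0
  let ?G = "fourier_coeff 1 (\<lambda>x. bit_sign (x 0))"
  define e :: "nat \<Rightarrow> bit" where "e = (\<lambda>i. if i = 0 then 1 else 0)"
  have V: "F2vec 1 = {0, e}" unfolding e_def by (rule F2vec_1)
  have ne: "e \<noteq> 0" by (auto simp: e_def fun_eq_iff)
  have G: "?G 0 = 0" "?G e = 1"
    using fourier_coeff_dictator [of 0] fourier_coeff_dictator [of e] V ne by auto
  have "(\<Sum>S\<in>A. (?G S)\<^sup>2) \<le> 4 * log_card A" if "F2.subspace A" "A \<subseteq> F2vec 1" for A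
  proof -
    \<comment> \<open>The two subspaces of the line have masses 0 and 1, and logarithms 0 and
      1.\<close>
    have "A = {0} \<or> A = {0, e}" using that V F2.subspace_0 by blast
    then show ?thesis using ne G by (auto simp: log_card_def)
  qed
  then have "spread_measure 1 (\<lambda>S. (?G S)\<^sup>2)"
    using ne G V by (auto simp: spread_measure_def)
  with G show ?case by (simp only: power_0 Maj3_iter.simps simp_thms)
next
  case (Suc k)
  let ?m = "3 ^ k :: nat"
  let ?G = "fourier_coeff ?m (Maj3_iter k)"
  let ?H = "fourier_coeff (3 * ?m) (Maj3_iter (Suc k))"
  have G0: "?G 0 = 0" using Suc by blast
  note rec = fourier_coeff_Maj3_comp [of "Maj3_iter k", OF Maj3_iter_sign, of _ ?m, folded Maj3_iter_Suc]
  have "join3 ?m 0 0 0 = 0" by (simp add: join3_def fun_eq_iff)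
  then have H0: "?H 0 = 0" using rec [of 0 0 0] G0 by simp
  have "spread_measure (3 * ?m) (\<lambda>S. (?H S)\<^sup>2)"
  proof (rule spread_measure_join3 [OF conjunct2 [OF Suc]])
    fix a b c assume abc: "a \<in> F2vec ?m" "b \<in> F2vec ?m" "c \<in> F2vec ?m"
    have "4 * (?H (join3 ?m a b c))\<^sup>2 = (2 * ?H (join3 ?m a b c))\<^sup>2" by (simp add: power_mult_distrib)
    also have "\<dots> = (?G a)\<^sup>2 * of_bool (b = 0) * of_bool (c = 0)
        + of_bool (a = 0) * (?G b)\<^sup>2 * of_bool (c = 0) + of_bool (a = 0) * of_bool (b = 0) * (?G c)\<^sup>2
        + (?G a)\<^sup>2 * (?G b)\<^sup>2 * (?G c)\<^sup>2"
      \<comment> \<open>At most one of the four terms is nonzero: wherever an indicator of one term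
        forces a block to be 0, any other term containing \<open>?G\<close> of that block vanishes
        by \<open>G0\<close>. Hence the square is the sum of squares, and the minus sign
        disappears.\<close>
      unfolding rec [OF abc]
      by (cases "a = 0"; cases "b = 0"; cases "c = 0") (simp_all add: G0 power_mult_distrib)
    finally show "4 * (?H (join3 ?m a b c))\<^sup>2 = (?G a)\<^sup>2 * of_bool (b = 0) * of_bool (c = 0)
        + of_bool (a = 0) * (?G b)\<^sup>2 * of_bool (c = 0) + of_bool (a = 0) * of_bool (b = 0) * (?G c)\<^sup>2
        + (?G a)\<^sup>2 * (?G b)\<^sup>2 * (?G c)\<^sup>2" .
  qed simp
  with H0 show ?case by (simp only: power_Suc simp_thms)
qed

theorem theorem4p2:
  fixes k n d :: nat and f :: "(nat \<Rightarrow> bit) \<Rightarrow> real" and A :: "(nat \<Rightarrow> bit) set"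
  assumes "k \<ge> 1" and "n = 3 ^ k" and "f = Maj3_iter k"
    and "d \<le> n"
    and "A \<subseteq> F2vec n" and "F2.subspace A" and "F2.dim A = d"
  shows "(\<Sum>S\<in>A. (fourier_coeff n f S)\<^sup>2) \<le> 4 * real d / real n"
proof -
  have fin: "finite A" using assms(5) by (rule finite_subset) simp
  have pos: "0 < card A" using fin F2.subspace_0 [OF assms(6)] by (auto simp: card_gt_0_iff)
  \<comment> \<open>Only here does the dimension enter: it bounds the logarithm of the cardinality
    used throughout the induction.\<close>
  have "real (card A) \<le> 2 ^ d"
    using card_le_F2_dim [OF fin] assms(7) by (metis of_nat_le_iff of_nat_numeral of_nat_power)
  then have "log_card A \<le> log 2 (2 ^ d)"
    unfolding log_card_def using pos by (subst log_le_cancel_iff) auto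
  then have "log_card A \<le> d" by (simp add: log_nat_power)
  moreover have "(\<Sum>S\<in>A. (fourier_coeff n f S)\<^sup>2) \<le> 4 * log_card A / n"
    using spread_measure_Maj3_iter [of k] assms by (simp add: spread_measure_def)
  ultimately show ?thesis
    by (smt (verit) divide_right_mono of_nat_0_le_iff)
qed

end
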